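(* For all complex $s\neq 0$, $u$, $v$, $z$ for which $\Gamma(2v)$ is defined and both the series on the left and the integral on the right (along the straight segment from $0$ to $s$) converge, $$\sum _{l=0}^{\infty } \frac{(-s)^l\, \Gamma (l+2 v)\, L_l^{u}(z)}{(l+u+1)!}=\int_0^s \frac{r^u (r+1)^{-2 v} s^{-u-1}\, \Gamma (2 v)}{\Gamma (u+1)} \, {}_1F_1\left(2 v;u+1;\frac{r z}{r+1}\right) dr .$$
   Context: $L_l^u(z)$ is the generalized Laguerre polynomial, ${}_1F_1(\alpha;\beta;w)$ is the Kummer confluent hypergeometric function, and for complex $w$ one writes $w!=\Gamma(w+1)$. Powers are principal values. *)

theory Defs
  imports "HOL-Complex_Analysis.Complex_Analysis"
begin

text \<open>The factorial of a complex number; only meaningful when \<open>w\<close> is not a negative integer,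
  since \<open>Gamma\<close> returns 0 at its poles.\<close>

definition complex_fact :: "complex \<Rightarrow> complex" where
  "complex_fact w = Gamma (w + 1)"

text \<open>The explicit (closed) form of the generalized Laguerre polynomial, which for non-integer
  \<open>u\<close> uses the binomial coefficient with complex upper argument.\<close>

definition laguerre :: "nat \<Rightarrow> complex \<Rightarrow> complex \<Rightarrow> complex" where
  "laguerre l u z = (\<Sum>i\<le>l. (-1) ^ i * ((of_nat l + u) gchoose (l - i)) * z ^ i / fact i)"

text \<open>The series of \<open>kummer a b w\<close> converges for every \<open>w\<close>; the value is only meaningful when
  \<open>b\<close> is not a non-positive integer, since division by zero yields 0.\<close>

definition kummer :: "complex \<Rightarrow> complex \<Rightarrow> complex \<Rightarrow> complex" where
  "kummer a b w = (\<Sum>n. pochhammer a n / pochhammer b n * w ^ n / fact n)"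

lemma kummer_eq_eval_fps: "kummer a b w = eval_fps (fps_hypergeo [a] [b] 1) w"
  by (simp add: kummer_def eval_fps_def field_simps)

lemma laguerre_0: "laguerre 0 u z = 1"
  by (simp add: laguerre_def)

lemma laguerre_1: "laguerre 1 u z = 1 + u - z"
  by (simp add: laguerre_def)

end

theory Submission
  imports Defs "HOL-Real_Asymp.Real_Asymp"
begin

text \<open>
  Put \<open>F(x) = (\<Sum>l. c\<^sub>l x\<^sup>l)\<close> with
  \<open>c\<^sub>l = (-1)\<^sup>l \<Gamma>(l + 2v) L\<^sub>l\<^sup>u(z) / \<Gamma>(l + u + 2)\<close>, so that the left-hand side is \<open>F(s)\<close>.
  The factor \<open>1 / \<Gamma>(l + u + 2) = 1 / ((l + u + 1) \<Gamma>(l + u + 1))\<close> says that the series for \<open>F\<close> is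
  an integrated one: the Euler operator \<open>H(x) = (u + 1) F(x) + x F'(x)\<close> multiplies the \<open>l\<close>-th
  coefficient by \<open>l + u + 1\<close>, and \<open>d/dt (t\<^bsup>u+1\<^esup> F(ts)) = t\<^sup>u H(ts)\<close>. On the other hand the
  binomial series gives the generating function
  \[\sum_l \frac{(a)_l}{(u+1)_l} L_l^u(z) (-x)^l = (1+x)^{-a}\, {}_1F_1(a; u+1; xz/(1+x))\]
  for \<open>|x| < 1\<close>, which for \<open>a = 2v\<close> identifies \<open>H\<close> with \<open>\<Gamma>(2v)/\<Gamma>(u+1)\<close> times the function
  in the integrand. Thus the integrand is, up to the substitution \<open>r = ts\<close>, the derivative of
  \<open>t\<^bsup>u+1\<^esup> F(ts)\<close>, and the theorem is the fundamental theorem of calculus on \<open>[0, 1]\<close>.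

  Three points need care, since the hypotheses are only convergence at \<open>s\<close> and integrability along
  the segment.

  \<^item> If \<open>|s| > 1\<close>, the identity for \<open>H\<close> is needed beyond the unit disc. Convergence at \<open>s\<close> makes
    \<open>H\<close> holomorphic on the disc of radius \<open>|s|\<close>, so the identity theorem carries it to that disc
    minus the cut \<open>(-\<infinity>, -1]\<close>. Principal powers are continuous from above on the cut, which
    gives the identity there as well, except at \<open>-1\<close> (\<open>kummer_form_continuation\<close>).

  \<^item> At \<open>t = 1\<close> the series may converge only conditionally; the value \<open>F(s)\<close> is the limit of
    \<open>F(ts)\<close> by Abel's theorem (\<open>Abel_limit\<close>).

  \<^item> At \<open>t = 0\<close> the boundary term \<open>t\<^bsup>u+1\<^esup> F(ts)\<close> must vanish.
    Integrability forces it to have some limit. As \<open>F(0) \<noteq> 0\<close>, the power \<open>t\<^bsup>u+1\<^esup>\<close> then has one too, and a nonconstant power \<open>t\<^sup>w\<close> that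
    converges at \<open>0\<close> can only converge to \<open>0\<close> (\<open>powr_at_right_0_limit_eq_0\<close>).
\<close>

section \<open>Kummer's series\<close>

lemma pochhammer_nonneg_of_nonneg:
  fixes a :: "'a :: linordered_semidom"
  shows "a \<ge> 0 \<Longrightarrow> pochhammer a n \<ge> 0"
  by (induction n) (auto simp: pochhammer_Suc)

lemma norm_pochhammer_le:
  fixes a :: "'a :: real_normed_field"
  shows "norm (pochhammer a n) \<le> pochhammer (norm a) n"
proof (induction n)
  case (Suc n)
  have "norm (pochhammer a (Suc n)) = norm (pochhammer a n) * norm (a + of_nat n)"
    by (simp add: pochhammer_Suc norm_mult)
  also have "\<dots> \<le> pochhammer (norm a) n * (norm a + of_nat n)"
    using norm_triangle_ineq[of a "of_nat n"] by (intro mult_mono Suc) (auto simp: pochhammer_nonneg_of_nonneg)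
  finally show ?case by (simp add: pochhammer_Suc)
qed simp

text \<open>
  The majorant of Kummer's series obtained by taking absolute values factor by factor; the
  quotient of consecutive terms is \<open>O(1/n)\<close>. Keeping \<open>norm (pochhammer b n)\<close> in the denominator
  avoids a lower bound for it; only the single factor \<open>b + n\<close> has to be bounded, for large \<open>n\<close>.
\<close>

lemma summable_kummer_majorant:
  fixes b :: complex
  assumes "A \<ge> 0" "y \<ge> 0" "b \<notin> \<int>\<^sub>\<le>\<^sub>0"
  shows "summable (\<lambda>n. pochhammer A n / norm (pochhammer b n) * y ^ n / fact n :: real)"
proof -
  define q where "q = (\<lambda>n. (A + real n) / ((real n - norm b) * (real n + 1)) * y)"
  have "q \<longlonglongrightarrow> 0"
    unfolding q_def by real_asymp
  hence "eventually (\<lambda>n. q n < 1/2) sequentially"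
    by (rule order_tendstoD) simp
  moreover have "eventually (\<lambda>n. real n > norm b) sequentially"
    by (rule eventually_compose_filterlim[OF eventually_gt_at_top filterlim_real_sequentially])
  ultimately have "eventually (\<lambda>n. q n < 1/2 \<and> real n > norm b) sequentially"
    by eventually_elim auto
  then obtain N where N: "\<And>n. n \<ge> N \<Longrightarrow> q n < 1/2 \<and> real n > norm b"
    unfolding eventually_sequentially by blast
  define T where "T = (\<lambda>n. pochhammer A n / norm (pochhammer b n) * y ^ n / fact n)"
  have "summable T"
  proof (rule summable_ratio_test[of "1/2" N])
    fix n assume "n \<ge> N"
    with N have n: "q n < 1/2" "real n > norm b" by auto
    have nz: "b + of_nat n \<noteq> 0"
      using assms(3) by (metis add_eq_0_iff2 minus_of_nat_in_nonpos_Ints eq_neg_iff_add_eq_0)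
    have T: "T k \<ge> 0" for k
      unfolding T_def using assms
      by (intro divide_nonneg_nonneg mult_nonneg_nonneg pochhammer_nonneg_of_nonneg) auto
    have "norm (b + of_nat n) \<ge> real n - norm b"
      by (metis add.commute norm_diff_ineq norm_of_nat)
    hence "(A + real n) / (norm (b + of_nat n) * (real n + 1)) * y \<le> q n"
      unfolding q_def using n assms nz
      by (intro mult_right_mono divide_left_mono mult_mono mult_pos_pos) auto
    also have "q n \<le> 1/2" using n by simp
    finally have "T n * ((A + real n) / (norm (b + of_nat n) * (real n + 1)) * y) \<le> T n * (1/2)"
      using T by (rule mult_left_mono)
    moreover have "T (Suc n) = T n * ((A + real n) / (norm (b + of_nat n) * (real n + 1)) * y)"
      by (simp add: T_def pochhammer_Suc norm_mult divide_inverse mult_ac add.commute)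
    ultimately show "norm (T (Suc n)) \<le> 1/2 * norm (T n)"
      using T[of n] T[of "Suc n"] by simp
  qed simp
  thus ?thesis by (simp add: T_def)
qed

lemma norm_summable_kummer:
  assumes "b \<notin> \<int>\<^sub>\<le>\<^sub>0"
  shows "summable (\<lambda>n. norm (pochhammer a n / pochhammer b n * w ^ n / fact n :: complex))"
proof (rule summable_comparison_test'[where N = 0])
  show "summable (\<lambda>n. pochhammer (norm a) n / norm (pochhammer b n) * norm w ^ n / fact n)"
    by (rule summable_kummer_majorant) (use assms in auto)
qed (auto simp: norm_mult norm_divide norm_power intro!: divide_right_mono mult_right_mono norm_pochhammer_le)

lemma holomorphic_kummer:
  assumes "b \<notin> \<int>\<^sub>\<le>\<^sub>0" "f holomorphic_on S"
  shows "(\<lambda>x. kummer a b (f x)) holomorphic_on S"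
proof -
  have "(\<lambda>w. kummer a b w) = (\<lambda>w. \<Sum>n. (pochhammer a n / pochhammer b n / fact n) * w ^ n)"
    by (simp add: kummer_def)
  moreover have "(\<lambda>w. \<Sum>n. (pochhammer a n / pochhammer b n / fact n) * w ^ n) holomorphic_on UNIV"
  proof -
    have "summable (\<lambda>n. pochhammer a n / pochhammer b n / fact n * w ^ n)" for w
      using summable_norm_cancel[OF norm_summable_kummer[OF assms(1), of a w]] by simp
    from termdiffs_strong_converges_everywhere[OF this] show ?thesis
      by (auto simp: holomorphic_on_open)
  qed
  ultimately have "kummer a b holomorphic_on UNIV" by simp
  from holomorphic_on_compose_gen[OF assms(2) this] show ?thesis by (simp add: o_def)
qed

section \<open>A generating function of the Laguerre polynomials\<close>

lemma neg_binomial_sums: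
  fixes y a :: complex
  assumes "norm y < 1"
  shows "(\<lambda>k. pochhammer a k * y ^ k / fact k) sums (1 - y) powr (-a)"
proof -
  have "((- a) gchoose k) * (- y) ^ k = pochhammer a k * y ^ k / fact k" for k
    by (simp add: gbinomial_pochhammer power_minus[of y] field_simps flip: power_add mult_2)
  with gen_binomial_complex[of "-y" "-a"] assms show ?thesis by simp
qed

lemma neg_binomial_sums_real:
  fixes y a :: real
  assumes "\<bar>y\<bar> < 1"
  shows "(\<lambda>k. pochhammer a k * y ^ k / fact k) sums (1 - y) powr (-a)"
proof -
  have "((- a) gchoose k) * (- y) ^ k = pochhammer a k * y ^ k / fact k" for k
    by (simp add: gbinomial_pochhammer power_minus[of y] field_simps flip: power_add mult_2)
  with gen_binomial_real[of "-y" "-a"] assms show ?thesis by simp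
qed

text \<open>
  Expanding \<open>(1 - y)\<^bsup>-a-n\<^esup>\<close> in the \<open>n\<close>-th term \<open>(1 - y)\<^bsup>-a\<^esup> (w / (1 - y))\<^sup>n\<close> of the right-hand side
  turns it into a double series, because \<open>(a)\<^sub>n (a + n)\<^sub>k = (a)\<^bsub>n+k\<^esub>\<close>. The double series is
  absolutely summable: replacing \<open>a\<close>, \<open>w\<close>, \<open>y\<close> by their norms gives a majorant whose rows are again
  binomial series and whose row sums form a Kummer majorant. The terms may therefore be
  rearranged freely.
\<close>

lemma kummer_double_series:
  fixes a b w y :: complex
  assumes "b \<notin> \<int>\<^sub>\<le>\<^sub>0" "norm y < 1"
  shows "((\<lambda>(n,k). pochhammer a (n + k) * w ^ n * y ^ k / (pochhammer b n * fact n * fact k))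
            has_sum (1 - y) powr (-a) * kummer a b (w / (1 - y))) UNIV"
proof -
  define f where "f = (\<lambda>(n,k). pochhammer a (n + k) * w ^ n * y ^ k / (pochhammer b n * fact n * fact k))"
  define F where "F = (\<lambda>(n,k). pochhammer (norm a) (n + k) * norm w ^ n * norm y ^ k
                                 / (norm (pochhammer b n) * fact n * fact k))"
  define A where "A = norm a"
  define g where "g = (\<lambda>n. (1 - norm y) powr (-A) *
                         (pochhammer A n / norm (pochhammer b n) * (norm w / (1 - norm y)) ^ n / fact n))"
  define h where "h = (\<lambda>n. (1 - y) powr (-a) *
                         (pochhammer a n / pochhammer b n * (w / (1 - y)) ^ n / fact n))"
  have [simp]: "A \<ge> 0" "y \<noteq> 1" using assms by (auto simp: A_def)
  have F_nonneg: "F p \<ge> 0" for p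
    by (auto simp: F_def case_prod_unfold intro!: divide_nonneg_nonneg mult_nonneg_nonneg pochhammer_nonneg_of_nonneg)
  have row_F: "((\<lambda>k. F (n, k)) has_sum g n) UNIV" for n
  proof (rule sums_nonneg_imp_has_sum)
    have "(\<lambda>k. pochhammer A n * norm w ^ n / (norm (pochhammer b n) * fact n) *
              (pochhammer (A + of_nat n) k * norm y ^ k / fact k))
            sums (pochhammer A n * norm w ^ n / (norm (pochhammer b n) * fact n) *
              (1 - norm y) powr (-(A + of_nat n)))"
      by (intro sums_mult neg_binomial_sums_real) (use assms in auto)
    moreover have "pochhammer A n * norm w ^ n / (norm (pochhammer b n) * fact n) *
              (1 - norm y) powr (-(A + of_nat n)) = g n"
      using assms by (simp add: g_def powr_diff powr_realpow field_simps)
    ultimately show "(\<lambda>k. F (n, k)) sums g n"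
      by (simp add: F_def A_def pochhammer_product' field_simps)
  qed (use F_nonneg in auto)
  have "summable g"
    unfolding g_def by (intro summable_mult summable_kummer_majorant) (use assms in auto)
  hence "g summable_on UNIV"
    by (subst summable_on_UNIV_nonneg_real_iff)
       (use assms in \<open>auto simp: g_def intro!: divide_nonneg_nonneg mult_nonneg_nonneg pochhammer_nonneg_of_nonneg\<close>)
  hence "F summable_on (UNIV \<times> UNIV)"
    by (intro summable_on_SigmaI[where g = g]) (use row_F F_nonneg in auto)
  hence F_summable: "F summable_on UNIV" by simp
  have f_le_F: "norm (f p) \<le> F p" for p
    by (auto simp: f_def F_def case_prod_unfold norm_mult norm_divide norm_power
             intro!: divide_right_mono mult_right_mono norm_pochhammer_le)
  hence f_summable: "f summable_on UNIV"
    by (rule Infinite_Sum.abs_summable_summable[OF Infinite_Sum.abs_summable_on_comparison_test'[OF F_summable]])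
  have row_f: "((\<lambda>k. f (n, k)) has_sum h n) UNIV" for n
  proof (rule norm_summable_imp_has_sum)
    have "summable (\<lambda>k. F (n, k))"
      using has_sum_imp_sums[OF row_F] by (rule sums_summable)
    thus "summable (\<lambda>k. norm (f (n, k)))"
      by (rule summable_comparison_test'[where N = 0]) (use f_le_F in auto)
    have "(\<lambda>k. pochhammer a n * w ^ n / (pochhammer b n * fact n) *
              (pochhammer (a + of_nat n) k * y ^ k / fact k))
            sums (pochhammer a n * w ^ n / (pochhammer b n * fact n) *
              (1 - y) powr (-(a + of_nat n)))"
      by (intro sums_mult neg_binomial_sums) (use assms in auto)
    moreover have "pochhammer a n * w ^ n / (pochhammer b n * fact n) *
              (1 - y) powr (-(a + of_nat n)) = h n"
      using assms by (simp add: h_def powr_diff powr_nat' field_simps)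
    ultimately show "(\<lambda>k. f (n, k)) sums h n"
      by (simp add: f_def pochhammer_product' field_simps)
  qed
  have "(h has_sum (1 - y) powr (-a) * kummer a b (w / (1 - y))) UNIV"
    unfolding h_def kummer_def
    by (rule has_sum_cmult_right[OF norm_summable_imp_has_sum[OF _ summable_sums[OF summable_norm_cancel]]])
       (rule norm_summable_kummer[OF assms(1)])+
  hence "(f has_sum (1 - y) powr (-a) * kummer a b (w / (1 - y))) (UNIV \<times> UNIV)"
    by (rule has_sum_SigmaI[OF row_f]) (use f_summable in auto)
  thus ?thesis by (simp add: f_def)
qed

text \<open>
  In this form the dependence on \<open>l\<close> of the \<open>n\<close>-th term is, apart from a common factor, only
  \<open>1 / (l - n)!\<close>, as in the diagonals of a double series.
\<close>

lemma laguerre_pochhammer: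
  assumes "u + 1 \<notin> \<int>\<^sub>\<le>\<^sub>0"
  shows "laguerre l u z =
           pochhammer (u + 1) l * (\<Sum>n\<le>l. (-z) ^ n / (pochhammer (u + 1) n * fact n * fact (l - n)))"
proof -
  have "(-1) ^ n * ((of_nat l + u) gchoose (l - n)) * z ^ n / fact n
          = pochhammer (u + 1) l * ((-z) ^ n / (pochhammer (u + 1) n * fact n * fact (l - n)))"
    if "n \<le> l" for n
  proof -
    have nz: "pochhammer (u + 1) n \<noteq> 0"
      using assms by (auto simp: pochhammer_eq_0_iff)
    have "(of_nat l + u) gchoose (l - n) = pochhammer (u + 1 + of_nat n) (l - n) / fact (l - n)"
      using that by (simp add: gbinomial_pochhammer' of_nat_diff algebra_simps)
    moreover have "pochhammer (u + 1) l = pochhammer (u + 1) n * pochhammer (u + 1 + of_nat n) (l - n)"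
      by (rule pochhammer_product[OF that])
    ultimately show ?thesis
      using nz by (simp add: power_minus[of z] field_simps)
  qed
  thus ?thesis by (simp add: laguerre_def sum_distrib_left)
qed

text \<open>
  Summing the double series with \<open>w = x z\<close> and \<open>y = -x\<close> along the diagonals \<open>n + k = l\<close>, on which
  \<open>x\<^sup>n (-x)\<^sup>k\<close> is \<open>(-x)\<^sup>l\<close> up to the sign that Laguerre polynomials carry.
\<close>

lemma laguerre_generating_function:
  fixes a u x z :: complex
  assumes "u + 1 \<notin> \<int>\<^sub>\<le>\<^sub>0" "norm x < 1"
  shows "(\<lambda>l. pochhammer a l / pochhammer (u + 1) l * laguerre l u z * (-x) ^ l)
           sums ((1 + x) powr (-a) * kummer a (u + 1) (x * z / (1 + x)))"
proof -
  define b where "b = u + 1"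
  have b: "b \<notin> \<int>\<^sub>\<le>\<^sub>0" using assms by (simp add: b_def)
  define S where "S = (1 + x) powr (-a) * kummer a b (x * z / (1 + x))"
  define f where "f = (\<lambda>(n,k). pochhammer a (n + k) * (x * z) ^ n * (-x) ^ k / (pochhammer b n * fact n * fact k))"
  have "(f has_sum S) UNIV"
    unfolding f_def S_def using kummer_double_series[OF b, of "-x" a "x * z"] assms by simp
  also have "?this \<longleftrightarrow> ((\<lambda>(l,n). f (n, l - n)) has_sum S) (SIGMA l:UNIV. {..l})"
    by (rule has_sum_reindex_bij_witness[where i = "\<lambda>(l,n). (n, l - n)" and j = "\<lambda>(n,k). (n + k, n)"]) auto
  finally have "((\<lambda>l. \<Sum>n\<le>l. f (n, l - n)) has_sum S) UNIV"
    by (rule has_sum_SigmaD) (auto intro: has_sum_finite)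
  hence "(\<lambda>l. \<Sum>n\<le>l. f (n, l - n)) sums S"
    by (rule has_sum_imp_sums)
  moreover have "(\<Sum>n\<le>l. f (n, l - n)) = pochhammer a l / pochhammer b l * laguerre l u z * (-x) ^ l" for l
  proof -
    have nz: "pochhammer b l \<noteq> 0"
      using b by (auto simp: pochhammer_eq_0_iff)
    have "f (n, l - n) = pochhammer a l * (-x) ^ l * ((-z) ^ n / (pochhammer b n * fact n * fact (l - n)))"
      if "n \<le> l" for n
    proof -
      have "(x * z) ^ n * (-x) ^ (l - n) = ((-x) ^ n * (-x) ^ (l - n)) * (-z) ^ n"
        by (simp flip: power_mult_distrib)
      also have "(-x) ^ n * (-x) ^ (l - n) = (-x) ^ l"
        using that by (simp flip: power_add)
      finally show ?thesis using that by (simp add: f_def mult_ac)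
    qed
    hence "(\<Sum>n\<le>l. f (n, l - n)) =
             pochhammer a l * (-x) ^ l * (\<Sum>n\<le>l. (-z) ^ n / (pochhammer b n * fact n * fact (l - n)))"
      by (simp add: sum_distrib_left)
    with nz show ?thesis
      using laguerre_pochhammer[OF assms(1), of l z] by (simp add: b_def field_simps)
  qed
  ultimately show ?thesis by (simp add: S_def b_def)
qed

section \<open>Continuation up to the branch cut\<close>

text \<open>
  On the closed upper half-plane without \<open>0\<close> the principal logarithm agrees with
  \<open>Ln (- \<i> * y) + \<i> * pi / 2\<close>, whose cut is the negative imaginary axis. So principal powers are
  continuous from above at the negative real axis, where the principal argument is \<open>pi\<close>.
\<close>

lemma tendsto_powr_from_above:
  fixes w a :: complex
  assumes "w \<noteq> 0" "Im w \<ge> 0"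
  shows "((\<lambda>e. (w + \<i> * of_real e) powr a) \<longlongrightarrow> w powr a) (at_right 0)"
proof -
  have rot: "y powr a = exp (a * (Ln (- \<i> * y) + \<i> * of_real pi / 2))" if "y \<noteq> 0" "Im y \<ge> 0" for y
    using that Ln_times_ii[of "- \<i> * y"] by (simp add: powr_def)
  have "- \<i> * w \<notin> \<real>\<^sub>\<le>\<^sub>0"
    using assms by (auto simp: complex_nonpos_Reals_iff complex_eq_iff)
  hence "((\<lambda>e. exp (a * (Ln (- \<i> * (w + \<i> * of_real e)) + \<i> * of_real pi / 2)))
          \<longlongrightarrow> exp (a * (Ln (- \<i> * (w + \<i> * of_real 0)) + \<i> * of_real pi / 2))) (at_right 0)"
    by (intro tendsto_intros) auto
  moreover have "eventually (\<lambda>e. exp (a * (Ln (- \<i> * (w + \<i> * of_real e)) + \<i> * of_real pi / 2))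
                    = (w + \<i> * of_real e) powr a) (at_right 0)"
    using eventually_at_right_less[of 0]
  proof eventually_elim
    case (elim e)
    hence "Im (w + \<i> * of_real e) > 0" using assms by simp
    hence "w + \<i> * of_real e \<noteq> 0" by (metis zero_complex.simps(2) less_irrefl)
    with rot[of "w + \<i> * of_real e"] \<open>Im (w + \<i> * of_real e) > 0\<close> show ?case by simp
  qed
  ultimately have "((\<lambda>e. (w + \<i> * of_real e) powr a) \<longlongrightarrow> exp (a * (Ln (- \<i> * w) + \<i> * of_real pi / 2))) (at_right 0)"
    by (auto elim: Lim_transform_eventually)
  with rot[OF assms] show ?thesis by simp
qed

text \<open>
  The domain for the identity theorem: a disc minus the cut of \<open>(x + 1) powr a\<close>. It is connected
  because it is star-shaped about \<open>0\<close>.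
\<close>

lemma slit_ball:
  fixes R :: real
  assumes "R > 0"
  defines "S \<equiv> {x :: complex. norm x < R \<and> x + 1 \<notin> \<real>\<^sub>\<le>\<^sub>0}"
  shows "open S" "connected S" "0 \<in> S"
proof -
  have S_eq: "S = ball 0 R \<inter> (\<lambda>x. x + 1) -` (- \<real>\<^sub>\<le>\<^sub>0)"
    by (auto simp: S_def)
  show "open S"
    unfolding S_eq by (intro open_Int open_vimage open_Compl closed_nonpos_Reals_complex open_ball continuous_intros)
  show 0: "0 \<in> S"
    using assms by (auto simp: S_def complex_nonpos_Reals_iff)
  have "closed_segment 0 x \<subseteq> S" if "x \<in> S" for x
  proof
    fix y assume "y \<in> closed_segment 0 x"
    then obtain t where t: "y = of_real t * x" "0 \<le> t" "t \<le> 1"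
      by (auto simp: in_segment scaleR_conv_of_real)
    have "t * norm x \<le> 1 * norm x" using t by (intro mult_right_mono) auto
    moreover have "norm x < R" using that by (auto simp: S_def)
    ultimately have "norm y < R"
      using t by (simp add: norm_mult)
    moreover have "y + 1 \<notin> \<real>\<^sub>\<le>\<^sub>0"
    proof
      assume "y + 1 \<in> \<real>\<^sub>\<le>\<^sub>0"
      hence *: "t * Re x \<le> -1" "t * Im x = 0"
        using t by (auto simp: complex_nonpos_Reals_iff)
      hence "Im x = 0" by auto
      moreover have "Re x \<le> -1"
      proof (rule ccontr)
        assume "\<not> Re x \<le> -1"
        hence "t * (Re x + 1) \<ge> 0" "t < 1 \<or> t * (Re x + 1) > 0"
          using t by (auto simp: not_le less_le)
        with * t show False by (auto simp: algebra_simps)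
      qed
      ultimately have "x + 1 \<in> \<real>\<^sub>\<le>\<^sub>0"
        by (auto simp: complex_nonpos_Reals_iff)
      with that show False by (auto simp: S_def)
    qed
    ultimately show "y \<in> S" by (auto simp: S_def)
  qed
  with 0 have "starlike S" unfolding starlike_def by blast
  thus "connected S" by (rule starlike_imp_connected)
qed

text \<open>
  The right-hand side is holomorphic off the cut \<open>(-\<infinity>, -1]\<close>, so the identity theorem applies there.
  At a point of the cut other than \<open>-1\<close> both sides are the limits of their values from above.
\<close>

lemma kummer_form_continuation:
  fixes H :: "complex \<Rightarrow> complex"
  assumes R: "R > 0" and b: "b \<notin> \<int>\<^sub>\<le>\<^sub>0" and H: "H holomorphic_on ball 0 R"
    and eq: "\<And>x. norm x < R \<Longrightarrow> norm x < 1 \<Longrightarrow> H x = (x + 1) powr a * kummer c b (x * z / (x + 1))"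
    and x: "norm x < R" "x \<noteq> -1"
  shows "H x = (x + 1) powr a * kummer c b (x * z / (x + 1))"
proof -
  define S where "S = {x :: complex. norm x < R \<and> x + 1 \<notin> \<real>\<^sub>\<le>\<^sub>0}"
  note S = slit_ball[OF R, folded S_def]
  define h where "h = (\<lambda>x. (x + 1) powr a * kummer c b (x * z / (x + 1)))"
  have on_S: "H y = h y" if "y \<in> S" for y
  proof (rule analytic_continuation_open[of "ball 0 (min R 1)" S H h])
    show "ball 0 (min R 1) \<subseteq> S"
    proof
      fix y :: complex assume y: "y \<in> ball 0 (min R 1)"
      hence "\<bar>Re y\<bar> < 1" using abs_Re_le_cmod[of y] by auto
      with y show "y \<in> S" by (auto simp: S_def complex_nonpos_Reals_iff)
    qed
    show "H holomorphic_on S"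
      using H by (rule holomorphic_on_subset) (auto simp: S_def)
    show "h holomorphic_on S"
      unfolding h_def by (intro holomorphic_intros holomorphic_kummer b) (auto simp: S_def)
    show "H y = h y" if "y \<in> ball 0 (min R 1)" for y
      using eq[of y] that by (simp add: h_def)
  qed (use S R that in auto)
  show ?thesis
  proof (cases "x \<in> S")
    case True
    with on_S show ?thesis by (simp add: h_def)
  next
    case False
    hence cut: "x + 1 \<in> \<real>\<^sub>\<le>\<^sub>0" using x by (simp add: S_def)
    hence Im: "Im x = 0" by (simp add: complex_nonpos_Reals_iff)
    have nz: "x + 1 \<noteq> 0" using x by (simp add: eq_neg_iff_add_eq_0)
    \<comment> \<open>The approach from above is the side on which the principal power is continuous.\<close>
    have path: "((\<lambda>e. x + \<i> * of_real e) \<longlongrightarrow> x) (at_right 0)"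
      by (auto intro!: tendsto_eq_intros)
    have "isCont H x"
      using H x continuous_on_eq_continuous_at[OF open_ball] holomorphic_on_imp_continuous_on
      by (metis mem_ball_0)
    hence H_lim: "((\<lambda>e. H (x + \<i> * of_real e)) \<longlongrightarrow> H x) (at_right 0)"
      using path by (rule isCont_tendsto_compose)
    have "(\<lambda>y. kummer c b y) holomorphic_on UNIV"
      by (intro holomorphic_kummer b holomorphic_intros)
    hence "isCont (kummer c b) (x * z / (x + 1))"
      using continuous_on_eq_continuous_at[OF open_UNIV] holomorphic_on_imp_continuous_on by blast
    hence "((\<lambda>e. kummer c b ((x + \<i> * of_real e) * z / ((x + \<i> * of_real e) + 1)))
              \<longlongrightarrow> kummer c b (x * z / (x + 1))) (at_right 0)"
      by (rule isCont_tendsto_compose) (intro tendsto_intros path nz)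
    moreover have "((\<lambda>e. ((x + 1) + \<i> * of_real e) powr a) \<longlongrightarrow> (x + 1) powr a) (at_right 0)"
      by (rule tendsto_powr_from_above) (use nz Im in auto)
    ultimately have h_lim: "((\<lambda>e. h (x + \<i> * of_real e)) \<longlongrightarrow> h x) (at_right 0)"
      unfolding h_def by (auto intro!: tendsto_mult simp: add_ac)
    have "eventually (\<lambda>e. norm (x + \<i> * of_real e) < R) (at_right 0)"
      by (rule order_tendstoD[OF tendsto_norm[OF path]]) (use x in auto)
    hence "eventually (\<lambda>e. H (x + \<i> * of_real e) = h (x + \<i> * of_real e)) (at_right 0)"
      using eventually_at_right_less[of 0]
    proof eventually_elim
      case (elim e)
      with Im show ?case by (intro on_S) (auto simp: S_def complex_nonpos_Reals_iff)
    qed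
    from Lim_transform_eventually[OF H_lim this] have "H x = h x"
      using h_lim by (intro tendsto_unique[of "at_right (0::real)"]) auto
    thus ?thesis by (simp add: h_def)
  qed
qed

section \<open>Integrating along the segment\<close>

text \<open>
  Abel's limit theorem, for radial approach. With the remainders \<open>r n = (\<Sum>k\<le>n. b k) - suminf b\<close>,
  summation by parts gives \<open>(\<Sum>n. t\<^sup>n b n) - suminf b = (1 - t) (\<Sum>n. t\<^sup>n r n)\<close>. The finitely many
  remainders that are not small contribute \<open>O(1 - t)\<close>, the others a small multiple of
  \<open>(1 - t) (\<Sum>n. t\<^sup>n) = 1\<close>.
\<close>

lemma Abel_limit:
  fixes b :: "nat \<Rightarrow> 'a :: {real_normed_algebra_1, banach}"
  assumes "summable b"
  shows "((\<lambda>t::real. \<Sum>n. t ^ n *\<^sub>R b n) \<longlongrightarrow> suminf b) (at_left 1)"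
proof (rule tendstoI)
  fix e :: real assume e: "e > 0"
  define B where "B = suminf b"
  define r where "r = (\<lambda>n. (\<Sum>k\<le>n. b k) - B)"
  have "(\<lambda>n. \<Sum>k\<le>n. b k) \<longlonglongrightarrow> B"
    unfolding B_def using assms by (rule summable_LIMSEQ')
  hence r: "r \<longlonglongrightarrow> 0"
    unfolding r_def by (simp add: LIM_zero)
  hence "eventually (\<lambda>n. norm (r n) < e/2) sequentially"
    using e by (auto simp: tendsto_iff dest: spec[of _ "e/2"])
  then obtain N where N: "\<And>n. n \<ge> N \<Longrightarrow> norm (r n) < e/2"
    unfolding eventually_sequentially by blast
  define C where "C = (\<Sum>n<N. norm (r n))"
  have bound: "norm ((\<Sum>n. t ^ n *\<^sub>R b n) - B) \<le> (1 - t) * C + e/2" if t: "0 \<le> t" "t < 1" for t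
  proof -
    define M where "M = (\<lambda>n. (if n < N then norm (r n) else 0) + e/2 * t ^ n)"
    have M: "M sums (C + e/2 * (1 / (1 - t)))"
      unfolding M_def C_def using t
      by (intro sums_add sums_mult geometric_sums sums_If_finite_set[of "{..<N}", simplified]) auto
    have le: "norm (t ^ n *\<^sub>R r n) \<le> M n" for n
    proof (cases "n < N")
      case True
      have "t ^ n * norm (r n) \<le> 1 * norm (r n)"
        using t by (intro mult_right_mono power_le_one) auto
      thus ?thesis using True t e by (auto simp: M_def intro: add_increasing2)
    next
      case False
      hence "t ^ n * norm (r n) \<le> t ^ n * (e/2)"
        using t N[of n] by (intro mult_left_mono) auto
      thus ?thesis using False t by (simp add: M_def mult_ac)
    qed
    have smr: "summable (\<lambda>n. t ^ n *\<^sub>R r n)"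
      by (rule summable_comparison_test'[OF sums_summable[OF M], of 0]) (use le in auto)
    define R where "R = (\<Sum>n. t ^ n *\<^sub>R r n)"
    have R: "(\<lambda>n. t ^ n *\<^sub>R r n) sums R"
      unfolding R_def using smr by (rule summable_sums)
    have "norm R \<le> C + e/2 * (1 / (1 - t))"
      unfolding R_def using norm_suminf_le[OF le sums_summable[OF M]] sums_unique[OF M] by simp
    hence "(1 - t) * norm R \<le> (1 - t) * (C + e/2 * (1 / (1 - t)))"
      using t by (intro mult_left_mono) auto
    also have "\<dots> = (1 - t) * C + e/2"
      using t by (simp add: field_simps)
    finally have nR: "(1 - t) * norm R \<le> (1 - t) * C + e/2" .
    \<comment> \<open>Summation by parts: \<open>b (Suc n) = r (Suc n) - r n\<close> and \<open>b 0 = r 0 + B\<close>.\<close>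
    have "(\<lambda>n. t ^ Suc n *\<^sub>R r (Suc n)) sums (R - r 0)"
      using R sums_Suc_iff[of "\<lambda>n. t ^ n *\<^sub>R r n" "R - r 0"] by simp
    hence "(\<lambda>n. t ^ Suc n *\<^sub>R r (Suc n) - t *\<^sub>R (t ^ n *\<^sub>R r n)) sums (R - r 0 - t *\<^sub>R R)"
      by (intro sums_diff sums_scaleR_right R)
    moreover have "t ^ Suc n *\<^sub>R r (Suc n) - t *\<^sub>R (t ^ n *\<^sub>R r n) = t ^ Suc n *\<^sub>R b (Suc n)" for n
      by (simp add: r_def algebra_simps)
    ultimately have "(\<lambda>n. t ^ Suc n *\<^sub>R b (Suc n)) sums (R - r 0 - t *\<^sub>R R)"
      by simp
    hence "(\<lambda>n. t ^ n *\<^sub>R b n) sums (R - r 0 - t *\<^sub>R R + b 0)"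
      using sums_Suc_iff[of "\<lambda>n. t ^ n *\<^sub>R b n" "R - r 0 - t *\<^sub>R R"] by simp
    hence "(\<Sum>n. t ^ n *\<^sub>R b n) - B = (1 - t) *\<^sub>R R"
      by (simp add: sums_iff r_def algebra_simps)
    with nR t show ?thesis by simp
  qed
  have "((\<lambda>t. (1 - t) * C + e/2) \<longlongrightarrow> (1 - 1) * C + e/2) (at_left (1::real))"
    by (intro tendsto_intros)
  hence "eventually (\<lambda>t. (1 - t) * C + e/2 < e) (at_left (1::real))"
    by (rule order_tendstoD) (use e in simp)
  moreover have "eventually (\<lambda>t. t \<in> {0<..<1}) (at_left (1::real))"
    by (rule eventually_at_leftI[of 0]) auto
  ultimately show "eventually (\<lambda>t. dist (\<Sum>n. t ^ n *\<^sub>R b n) (suminf b) < e) (at_left 1)"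
  proof eventually_elim
    case (elim t)
    with bound[of t] show ?case by (simp add: dist_norm B_def)
  qed
qed

text \<open>
  If \<open>t powr w\<close> tends to \<open>M\<close>, then replacing \<open>t\<close> by \<open>exp a * t\<close> shows \<open>M = exp (a * w) * M\<close> for every
  real \<open>a\<close>. As \<open>w \<noteq> 0\<close>, some \<open>a\<close> makes \<open>exp (a * w) \<noteq> 1\<close>, hence \<open>M = 0\<close>.
\<close>

lemma powr_at_right_0_limit_eq_0:
  fixes w M :: complex
  assumes "w \<noteq> 0" "((\<lambda>t. of_real t powr w) \<longlongrightarrow> M) (at_right 0)"
  shows "M = 0"
proof -
  \<comment> \<open>Then \<open>a * w\<close> has norm \<open>1\<close>, which is too small for a nonzero period of \<open>exp\<close>.\<close>
  define a where "a = 1 / norm w"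
  have "filterlim (\<lambda>t. exp a * t) (at_right 0) (at_right (0::real))"
    unfolding filterlim_at by (auto intro!: tendsto_eq_intros simp: eventually_at_filter)
  hence "((\<lambda>t. of_real (exp a * t) powr w) \<longlongrightarrow> M) (at_right 0)"
    using assms(2) by (rule filterlim_compose[rotated])
  moreover have "eventually (\<lambda>t. of_real (exp a * t) powr w = exp (a * w) * of_real t powr w) (at_right (0::real))"
    using eventually_at_right_less[of 0]
    by eventually_elim (simp add: powr_def Ln_times_of_real Ln_of_real exp_of_real[symmetric] algebra_simps exp_add)
  ultimately have "((\<lambda>t. exp (a * w) * of_real t powr w) \<longlongrightarrow> M) (at_right 0)"
    by (rule Lim_transform_eventually)
  moreover have "((\<lambda>t. exp (a * w) * of_real t powr w) \<longlongrightarrow> exp (a * w) * M) (at_right 0)"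
    by (intro tendsto_intros assms)
  ultimately have "M = exp (a * w) * M"
    by (intro tendsto_unique[of "at_right (0::real)"]) auto
  moreover have "exp (a * w) \<noteq> 1"
  proof
    assume "exp (a * w) = 1"
    then obtain n :: int where "Re (a * w) = 0" "Im (a * w) = of_int (2 * n) * pi"
      unfolding exp_eq_1 by blast
    hence "norm (a * w) = \<bar>of_int (2 * n) * pi\<bar>"
      by (metis cmod_eq_Im)
    moreover have "norm (a * w) = 1"
      using assms by (simp add: a_def norm_divide)
    ultimately have *: "1 = 2 * \<bar>real_of_int n\<bar> * pi"
      by (simp add: abs_mult)
    hence "n \<noteq> 0" by auto
    hence "\<bar>real_of_int n\<bar> \<ge> 1" by linarith
    hence "2 * \<bar>real_of_int n\<bar> * pi \<ge> 2 * 1 * pi"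
      by (intro mult_mono) auto
    with * pi_gt3 show False by linarith
  qed
  ultimately show ?thesis by auto
qed

text \<open>
  Applied with \<open>w = u + 1\<close>, this cancels the factor \<open>l + u + 1\<close> that separates \<open>\<Gamma>(l + u + 2)\<close> from
  \<open>\<Gamma>(l + u + 1)\<close>.
\<close>

lemma power_series_Euler_operator:
  fixes c :: "nat \<Rightarrow> complex"
  assumes F: "\<And>y. norm y < R \<Longrightarrow> (\<lambda>n. c n * y ^ n) sums F y" and x: "norm x < R"
  shows "(\<lambda>n. (w + of_nat n) * c n * x ^ n) sums (w * F x + x * deriv F x)"
proof -
  have "F holomorphic_on ball 0 R"
    by (rule power_series_holomorphic[of _ _ c]) (use F in auto)
  hence "(F has_field_derivative deriv F x) (at x)"
    by (rule holomorphic_derivI[OF _ open_ball]) (use x in auto)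
  hence "(\<lambda>n. diffs c n * x ^ n) sums deriv F x"
    by (intro termdiffs_sums_strong[where K = R and f = F] F x)
  hence "(\<lambda>n. x * (diffs c n * x ^ n)) sums (x * deriv F x)"
    by (rule sums_mult)
  also have "(\<lambda>n. x * (diffs c n * x ^ n)) = (\<lambda>n. of_nat (Suc n) * c (Suc n) * x ^ Suc n)"
    by (simp add: diffs_def mult_ac)
  finally have "(\<lambda>n. of_nat n * c n * x ^ n) sums (x * deriv F x)"
    by (subst (asm) sums_Suc_iff) simp
  from sums_add[OF sums_mult[OF F[OF x], of w] this] show ?thesis
    by (simp add: algebra_simps)
qed

text \<open>
  On \<open>(0, 1)\<close> the function \<open>g\<close> is the derivative of \<open>\<Phi> t = t\<^sup>w F(ts)\<close>, up to finitely many points. So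
  \<open>\<Phi>\<close> differs by a constant \<open>K\<close> from the indefinite integral \<open>G\<close>, which is continuous on all of
  \<open>[0, 1]\<close> since \<open>g\<close> is integrable there. At \<open>0\<close> this gives
  \<open>\<Phi> t \<longlongrightarrow> K\<close>, so that \<open>t\<^sup>w\<close> converges to \<open>K / F 0\<close>, whence \<open>K = 0\<close>. At \<open>1\<close> it gives \<open>G 1 = L\<close>.
\<close>

lemma integral_radial_primitive:
  fixes F :: "complex \<Rightarrow> complex" and g :: "real \<Rightarrow> complex"
  assumes w: "w \<noteq> 0" and F: "F holomorphic_on ball 0 (norm s)" "F 0 \<noteq> 0" and s: "s \<noteq> 0"
    and g: "g integrable_on {0..1}" and E: "finite E"
    and g_eq: "\<And>t. 0 < t \<Longrightarrow> t < 1 \<Longrightarrow> t \<notin> E \<Longrightarrow>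
                 g t = of_real t powr (w - 1) * (w * F (of_real t * s) + of_real t * s * deriv F (of_real t * s))"
    and L: "((\<lambda>t. F (of_real t * s)) \<longlongrightarrow> L) (at_left 1)"
  shows "integral {0..1} g = L"
proof -
  define \<Phi> where "\<Phi> = (\<lambda>t::real. of_real t powr w * F (of_real t * s))"
  define G where "G = (\<lambda>x. integral {0..x} g)"
  define K where "K = \<Phi> (1/2) - G (1/2)"
  have \<Phi>': "(\<Phi> has_vector_derivative
            of_real t powr (w - 1) * (w * F (of_real t * s) + of_real t * s * deriv F (of_real t * s))) (at t)"
    if t: "0 < t" "t < 1" for t
  proof -
    have "norm (of_real t * s) < norm s"
      using t s by (simp add: norm_mult)
    hence "(F has_field_derivative deriv F (of_real t * s)) (at (of_real t * s))"
      using F(1) by (intro holomorphic_derivI[of F "ball 0 (norm s)"]) auto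
    hence "((\<lambda>y. F (y * s)) has_field_derivative deriv F (of_real t * s) * s) (at (of_real t))"
      by (intro DERIV_chain'[where f = "\<lambda>y. y * s" and g = F]) (auto intro!: derivative_eq_intros)
    moreover have "((\<lambda>y. y powr w) has_field_derivative w * of_real t powr (w - 1)) (at (of_real t))"
      using t by (intro has_field_derivative_powr) auto
    ultimately have "((\<lambda>y. y powr w * F (y * s)) has_field_derivative
         (w * of_real t powr (w - 1) * F (of_real t * s) + deriv F (of_real t * s) * s * of_real t powr w))
         (at (of_real t))"
      by (rule DERIV_mult[rotated])
    also have "of_real t powr w = of_real t powr (w - 1) * of_real t"
      using t by (simp add: powr_diff)
    finally have "((\<lambda>y. y powr w * F (y * s)) has_field_derivative
         of_real t powr (w - 1) * (w * F (of_real t * s) + of_real t * s * deriv F (of_real t * s)))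
         (at (of_real t))"
      by (simp add: algebra_simps)
    from has_vector_derivative_real_field[OF this] show ?thesis
      by (simp add: \<Phi>_def)
  qed
  have increment: "\<Phi> y - \<Phi> x = G y - G x" if xy: "0 < x" "x \<le> y" "y < 1" for x y
  proof -
    have "((\<lambda>t. of_real t powr (w - 1) * (w * F (of_real t * s) + of_real t * s * deriv F (of_real t * s)))
             has_integral (\<Phi> y - \<Phi> x)) {x..y}"
    proof (rule fundamental_theorem_of_calculus[OF xy(2)], rule has_vector_derivative_at_within)
      fix t assume "t \<in> {x..y}"
      with xy show "(\<Phi> has_vector_derivative of_real t powr (w - 1) *
              (w * F (of_real t * s) + of_real t * s * deriv F (of_real t * s))) (at t)"
        by (intro \<Phi>') auto
    qed
    hence "(g has_integral (\<Phi> y - \<Phi> x)) {x..y}"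
      by (rule has_integral_spike_finite[OF E, rotated]) (use xy g_eq in auto)
    hence "integral {x..y} g = \<Phi> y - \<Phi> x"
      by (rule integral_unique)
    moreover have "G x + integral {x..y} g = G y"
      unfolding G_def using xy
      by (intro Henstock_Kurzweil_Integration.integral_combine integrable_on_subinterval[OF g]) auto
    ultimately show ?thesis by (metis add_diff_cancel_left')
  qed
  have \<Phi>_eq: "\<Phi> t = G t + K" if "0 < t" "t < 1" for t
    using increment[of t "1/2"] increment[of "1/2" t] that
    by (cases "t \<le> 1/2") (auto simp: K_def algebra_simps)
  have G_cont: "continuous_on {0..1} G"
    unfolding G_def by (rule indefinite_integral_continuous_1[OF g])
  have "K = 0"
  proof -
    have "(G \<longlongrightarrow> G 0) (at_right 0)"
      using G_cont by (rule continuous_on_Icc_at_rightD) simp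
    hence "((\<lambda>t. G t + K) \<longlongrightarrow> 0 + K) (at_right 0)"
      by (intro tendsto_intros) (simp add: G_def)
    moreover have ev: "eventually (\<lambda>t. t \<in> {0<..<1}) (at_right (0::real))"
      by (rule eventually_at_right_real) simp
    hence "eventually (\<lambda>t. G t + K = \<Phi> t) (at_right 0)"
      by eventually_elim (use \<Phi>_eq in auto)
    ultimately have "(\<Phi> \<longlongrightarrow> K) (at_right 0)"
      by (auto elim: Lim_transform_eventually)
    moreover have "isCont F 0"
      using F(1) s continuous_on_eq_continuous_at[OF open_ball] holomorphic_on_imp_continuous_on
      by (metis centre_in_ball zero_less_norm_iff)
    hence F_lim: "((\<lambda>t. F (of_real t * s)) \<longlongrightarrow> F 0) (at_right 0)"
      by (rule isCont_tendsto_compose) (auto intro!: tendsto_eq_intros)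
    ultimately have "((\<lambda>t. \<Phi> t / F (of_real t * s)) \<longlongrightarrow> K / F 0) (at_right 0)"
      using F(2) by (intro tendsto_intros)
    moreover have "eventually (\<lambda>t. F (of_real t * s) \<noteq> 0) (at_right 0)"
      using tendsto_imp_eventually_ne[OF F_lim F(2)] .
    hence "eventually (\<lambda>t. \<Phi> t / F (of_real t * s) = of_real t powr w) (at_right 0)"
      by eventually_elim (simp add: \<Phi>_def)
    ultimately have "((\<lambda>t. of_real t powr w) \<longlongrightarrow> K / F 0) (at_right 0)"
      by (rule Lim_transform_eventually)
    with w have "K / F 0 = 0"
      by (rule powr_at_right_0_limit_eq_0)
    with F(2) show ?thesis by simp
  qed
  have "((\<lambda>t. of_real t powr w * F (of_real t * s)) \<longlongrightarrow> of_real 1 powr w * L) (at_left 1)"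
    by (intro tendsto_intros L) auto
  hence "(\<Phi> \<longlongrightarrow> L) (at_left 1)"
    by (simp add: \<Phi>_def)
  moreover have "eventually (\<lambda>t. t \<in> {0<..<1}) (at_left (1::real))"
    by (rule eventually_at_left_real) simp
  hence "eventually (\<lambda>t. \<Phi> t = G t) (at_left 1)"
    by eventually_elim (use \<Phi>_eq \<open>K = 0\<close> in auto)
  ultimately have "(G \<longlongrightarrow> L) (at_left 1)"
    by (rule Lim_transform_eventually)
  moreover have "(G \<longlongrightarrow> G 1) (at_left 1)"
    using G_cont by (rule continuous_on_Icc_at_leftD) simp
  ultimately have "G 1 = L"
    by (intro tendsto_unique[of "at_left (1::real)"]) auto
  thus ?thesis by (simp add: G_def)
qed

section \<open>The integral representation of the Laguerre series\<close>

theorem theorem4p87: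
  fixes s u v z :: complex
  assumes "s \<noteq> 0"
    and "2 * v \<notin> \<int>\<^sub>\<le>\<^sub>0"
    and "u + 1 \<notin> \<int>\<^sub>\<le>\<^sub>0"
    and "summable (\<lambda>l. (-s) ^ l * Gamma (of_nat l + 2 * v) * laguerre l u z
                         / complex_fact (of_nat l + u + 1))"
    and "(\<lambda>r. r powr u * (r + 1) powr (- 2 * v) * s powr (- u - 1) * Gamma (2 * v) / Gamma (u + 1)
               * kummer (2 * v) (u + 1) (r * z / (r + 1))) contour_integrable_on (linepath 0 s)"
  shows "(\<Sum>l. (-s) ^ l * Gamma (of_nat l + 2 * v) * laguerre l u z
                 / complex_fact (of_nat l + u + 1))
       = contour_integral (linepath 0 s)
           (\<lambda>r. r powr u * (r + 1) powr (- 2 * v) * s powr (- u - 1) * Gamma (2 * v) / Gamma (u + 1)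
                 * kummer (2 * v) (u + 1) (r * z / (r + 1)))"
proof -
  define c where "c = (\<lambda>l. (-1) ^ l * Gamma (of_nat l + 2 * v) * laguerre l u z / complex_fact (of_nat l + u + 1))"
  define F where "F = (\<lambda>x. \<Sum>l. c l * x ^ l)"
  define H where "H = (\<lambda>x. (u + 1) * F x + x * deriv F x)"
  define C where "C = Gamma (2 * v) / Gamma (u + 1)"
  define f where "f = (\<lambda>r. r powr u * (r + 1) powr (- 2 * v) * s powr (- u - 1) * Gamma (2 * v) / Gamma (u + 1)
                 * kummer (2 * v) (u + 1) (r * z / (r + 1)))"
  define g where "g = (\<lambda>t. f (linepath 0 s t) * s)"
  have terms: "(-s) ^ l * Gamma (of_nat l + 2 * v) * laguerre l u z / complex_fact (of_nat l + u + 1)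
                 = c l * s ^ l" for l
    by (simp add: c_def power_minus[of s])
  have sm: "summable (\<lambda>l. c l * s ^ l)"
    using assms(4) unfolding terms .
  have F_sums: "(\<lambda>l. c l * x ^ l) sums F x" if "norm x < norm s" for x
    unfolding F_def by (rule summable_sums[OF powser_inside[OF sm that]])
  have C: "C \<noteq> 0"
    using assms by (simp add: C_def Gamma_eq_zero_iff)
  have F_hol: "F holomorphic_on ball 0 (norm s)"
    by (rule power_series_holomorphic[of _ _ c]) (use F_sums in auto)
  hence H_hol: "H holomorphic_on ball 0 (norm s)"
    unfolding H_def by (intro holomorphic_intros) auto
  have coeff: "(u + 1 + of_nat l) * c l =
          C * (pochhammer (2 * v) l / pochhammer (u + 1) l * laguerre l u z * (-1) ^ l)" for l
  proof -
    have nonpole: "u + 1 + of_nat l \<notin> \<int>\<^sub>\<le>\<^sub>0"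
      using assms(3) by (metis add_diff_cancel_right' nonpos_Ints_diff_Nats of_nat_in_Nats)
    hence nz: "u + 1 + of_nat l \<noteq> 0" by auto
    have "complex_fact (of_nat l + u + 1) = (u + 1 + of_nat l) * Gamma (u + 1 + of_nat l)"
      using Gamma_plus1[OF nonpole] by (simp add: complex_fact_def add_ac)
    hence "(u + 1 + of_nat l) * c l =
             (-1) ^ l * Gamma (2 * v + of_nat l) * laguerre l u z / Gamma (u + 1 + of_nat l)"
      using nz unfolding c_def by (simp add: add.commute)
    also have "\<dots> = C * (pochhammer (2 * v) l / pochhammer (u + 1) l * laguerre l u z * (-1) ^ l)"
      using assms(2,3) by (simp add: C_def pochhammer_Gamma Gamma_eq_zero_iff)
    finally show ?thesis .
  qed
  have H_eq: "H x = C * ((x + 1) powr (- 2 * v) * kummer (2 * v) (u + 1) (x * z / (x + 1)))"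
    if x: "norm x < norm s" "x \<noteq> -1" for x
  proof -
    have near: "H x / C = (x + 1) powr (- 2 * v) * kummer (2 * v) (u + 1) (x * z / (x + 1))"
      if "norm x < norm s" "norm x < 1" for x
    proof -
      have "(\<lambda>l. C * (pochhammer (2 * v) l / pochhammer (u + 1) l * laguerre l u z * (-x) ^ l)) sums
              (C * ((1 + x) powr (- (2 * v)) * kummer (2 * v) (u + 1) (x * z / (1 + x))))"
        by (rule sums_mult[OF laguerre_generating_function[OF assms(3) that(2)]])
      moreover have "(\<lambda>l. C * (pochhammer (2 * v) l / pochhammer (u + 1) l * laguerre l u z * (-x) ^ l)) sums H x"
        using power_series_Euler_operator[OF F_sums that(1), of "u + 1"]
        unfolding coeff H_def by (simp add: power_minus[of x] mult_ac)
      ultimately have "H x = C * ((1 + x) powr (- (2 * v)) * kummer (2 * v) (u + 1) (x * z / (1 + x)))"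
        using sums_unique2 by blast
      with C show ?thesis by (simp add: add_ac)
    qed
    have "H x / C = (x + 1) powr (- 2 * v) * kummer (2 * v) (u + 1) (x * z / (x + 1))"
    proof (rule kummer_form_continuation[where R = "norm s"])
      show "(\<lambda>x. H x / C) holomorphic_on ball 0 (norm s)"
        using H_hol C by (intro holomorphic_on_divide holomorphic_on_const)
    qed (use assms(1,3) near x in auto)
    with C show ?thesis by (simp add: field_simps)
  qed
  have "integral {0..1} g = F s"
  proof (rule integral_radial_primitive[OF _ F_hol])
    show "u + 1 \<noteq> 0" using assms(3) by auto
    have "F 0 = c 0" by (simp add: F_def)
    thus "F 0 \<noteq> 0"
      using coeff[of 0] C by (auto simp: laguerre_0)
    show "g integrable_on {0..1}"
      using assms(5) unfolding f_def[symmetric] g_def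
      by (auto simp: contour_integrable_on_def has_contour_integral_linepath integrable_on_def)
    \<comment> \<open>The only parameter at which the segment can meet \<open>-1\<close>, where the integrand is not controlled.\<close>
    show "finite {1 / norm s}" by simp
    show "g t = of_real t powr (u + 1 - 1) * ((u + 1) * F (of_real t * s) + of_real t * s * deriv F (of_real t * s))"
      if t: "0 < t" "t < 1" "t \<notin> {1 / norm s}" for t
    proof -
      have "norm (of_real t * s) < norm s"
        using t assms(1) by (simp add: norm_mult)
      moreover have "of_real t * s \<noteq> -1"
      proof
        assume "of_real t * s = -1"
        hence "norm (of_real t * s) = 1" by simp
        hence "t = 1 / norm s"
          using t(1) assms(1) by (simp add: norm_mult eq_divide_eq)
        thus False using t(3) by simp
      qed
      ultimately have H_ts: "H (of_real t * s) = C * ((of_real t * s + 1) powr (- 2 * v) *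
          kummer (2 * v) (u + 1) (of_real t * s * z / (of_real t * s + 1)))"
        by (rule H_eq)
      have "(of_real t * s) powr u = of_real t powr u * s powr u"
        using t by (intro powr_times_real_left) auto
      hence "g t = of_real t powr u * (s powr u * s powr (-u - 1) * s) * H (of_real t * s)"
        unfolding H_ts by (simp add: g_def f_def linepath_def scaleR_conv_of_real C_def)
      also have "s powr u * s powr (-u - 1) * s = 1"
        using assms(1) by (simp add: powr_diff powr_minus)
      finally show ?thesis by (simp add: H_def)
    qed
    have "((\<lambda>t::real. \<Sum>n. t ^ n *\<^sub>R (c n * s ^ n)) \<longlongrightarrow> (\<Sum>n. c n * s ^ n)) (at_left 1)"
      by (rule Abel_limit[OF sm])
    thus "((\<lambda>t. F (of_real t * s)) \<longlongrightarrow> F s) (at_left 1)"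
      by (simp add: F_def scaleR_conv_of_real power_mult_distrib mult_ac)
  qed fact
  moreover have "contour_integral (linepath 0 s) f = integral {0..1} g"
    by (simp add: contour_integral_integral g_def)
  ultimately show ?thesis
    unfolding terms by (simp add: F_def f_def)
qed

end
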